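(* Let $X$ be a separable $F$-space, let $T$ be a continuous linear operator on $X$, and let $\mathcal{A}\subset\mathcal{P}(\mathbb{Z}_+)$ be a hypercyclicity set. Let $\|\cdot\|$ be an $F$-norm inducing the topology of $X$. Suppose that there exist a dense subset $Y_0\subset X$, maps $S_n:Y_0\to X$, $n\ge 0$, and pairwise disjoint sets $A_k\in\mathcal{A}$, $k\ge 1$, such that for each $y\in Y_0$: (1) there exists $k_0\ge 1$ such that $\sum_{n\in A_k}S_ny$ converges unconditionally in $X$, uniformly in $k\ge k_0$; (2) for any $k_0\ge 1$ and any $\varepsilon>0$, there exists $k\ge k_0$ such that for any finite set $F\subset A_k$ and any $n\in\bigcup_{l\ge 1}A_l$ with $n\notin F$, we have $\big\|\sum_{i\in F}T^nS_iy\big\|\le\varepsilon$, and such that (for this same $k$) for any $\delta>0$ there exists $l_0\ge 1$ such that for any finite set $F\subset A_k$ and any $n\in\bigcup_{l\ge l_0}A_l$ with $n\notin F$, we have $\big\|\sum_{i\in F}T^nS_iy\big\|\le\delta$; (3) $\sup_{n\in A_k}\|T^nS_ny-y\|\to 0$ as $k\to\infty$. Then $T$ is $\mathcal{A}$-frequently hypercyclic.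
   Context: $\mathbb{Z}_+$ is the set of non-negative integers, $\mathbb{K}$ is the scalar field. An $F$-space is a topological vector space whose topology is induced by a complete translation-invariant metric. An $F$-norm on a vector space $X$ is a map $\|\cdot\|:X\to\mathbb{R}^+$ such that for all $x,y\in X$, $\lambda\in\mathbb{K}$: $\|x+y\|\le\|x\|+\|y\|$; $\|\lambda x\|\le\|x\|$ if $|\lambda|<1$; $\lim_{\lambda\to 0}\|\lambda x\|=0$; $\|x\|=0$ implies $x=0$. It induces the topology via $d(x,y)=\|x-y\|$. A family $\mathcal{A}\subset\mathcal{P}(\mathbb{Z}_+)$ is a non-trivial hereditarily upward family if $\emptyset\notin\mathcal{A}$ and, for every $A\in\mathcal{A}$ and $A\subset B\subset\mathbb{Z}_+$, one has $B\in\mathcal{A}$. It is a hypercyclicity set if, moreover, $\mathcal{A}$ contains a sequence $(A_k)_{k\ge1}$ of disjoint sets such that for any $j\in A_k$, any $j'\in A_{k'}$ with $j\ne j'$, one has $|j'-j|\ge\max\{k,k'\}$. For $x\in X$ and $V\subset X$, $N(x,V)=\{n\ge 0: T^nx\in V\}$. $T$ is $\mathcal{A}$-frequently hypercyclic if there exists $x\in X$ such that $N(x,V)\in\mathcal{A}$ for every non-empty open set $V\subset X$. "$\sum_{n\in A_k}S_ny$ converges unconditionally in $X$, uniformly in $k\ge k_0$" means: for any $\varepsilon>0$ there exists $N\ge 1$ such that for every $k\ge k_0$ and every finite set $F\subset A_k\cap[N,\infty)$, $\big\|\sum_{n\in F}S_ny\big\|<\varepsilon$. *)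

theory Defs
  imports "HOL-Analysis.Analysis"
begin

text \<open>
  The scalar field ranges over the class \<^class>\<open>real_normed_field\<close>. By the Gelfand-Mazur theorem
  (applied to the completion), every instance of this class is isometrically isomorphic to the
  reals or to the complex numbers, so this covers exactly the two usual choices.

  The class \<^class>\<open>topological_ab_group_add\<close> provides joint continuity of addition (and
  continuity of negation, which in a topological vector space follows from that of scalar
  multiplication).
\<close>

locale topological_vector_space = vector_space scl
  for scl :: "'k::real_normed_field \<Rightarrow> 'a::topological_ab_group_add \<Rightarrow> 'a" +
  assumes continuous_scale: "continuous_on UNIV (\<lambda>(c, x). scl c x)"

locale F_space = topological_vector_space scl
  for scl :: "'k::real_normed_field \<Rightarrow> 'a::topological_ab_group_add \<Rightarrow> 'a" +
  assumes complete_invariant_metric: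
    "\<exists>d. Metric_space UNIV d \<and> (\<forall>x y z. d (x + z) (y + z) = d x y)
       \<and> Metric_space.mtopology UNIV d = (euclidean :: 'a topology)
       \<and> Metric_space.mcomplete UNIV d"

definition F_norm :: "('k::real_normed_field \<Rightarrow> 'a::ab_group_add \<Rightarrow> 'a) \<Rightarrow> ('a \<Rightarrow> real) \<Rightarrow> bool"
  where "F_norm scl nrm \<longleftrightarrow>
    (\<forall>x. 0 \<le> nrm x) \<and>
    (\<forall>x y. nrm (x + y) \<le> nrm x + nrm y) \<and>
    (\<forall>c x. norm c < 1 \<longrightarrow> nrm (scl c x) \<le> nrm x) \<and>
    (\<forall>x. ((\<lambda>c. nrm (scl c x)) \<longlongrightarrow> 0) (at 0)) \<and>
    (\<forall>x. nrm x = 0 \<longrightarrow> x = 0)"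

definition induces_topology :: "('a::{ab_group_add, topological_space} \<Rightarrow> real) \<Rightarrow> bool"
  where "induces_topology nrm \<longleftrightarrow>
    Metric_space.mtopology UNIV (\<lambda>x y. nrm (x - y)) = (euclidean :: 'a topology)"

definition hereditarily_upward :: "nat set set \<Rightarrow> bool"
  where "hereditarily_upward \<A> \<longleftrightarrow> {} \<notin> \<A> \<and> (\<forall>A B. A \<in> \<A> \<longrightarrow> A \<subseteq> B \<longrightarrow> B \<in> \<A>)"

definition hypercyclicity_set :: "nat set set \<Rightarrow> bool"
  where "hypercyclicity_set \<A> \<longleftrightarrow> hereditarily_upward \<A> \<and>
    (\<exists>A :: nat \<Rightarrow> nat set.
       (\<forall>k\<ge>1. A k \<in> \<A>) \<and> disjoint_family_on A {1..} \<and>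
       (\<forall>k\<ge>1. \<forall>k'\<ge>1. \<forall>j\<in>A k. \<forall>j'\<in>A k'. j \<noteq> j' \<longrightarrow> \<bar>int j' - int j\<bar> \<ge> int (max k k')))"

definition return_set :: "('a \<Rightarrow> 'a) \<Rightarrow> 'a \<Rightarrow> 'a set \<Rightarrow> nat set"
  where "return_set T x V = {n. (T ^^ n) x \<in> V}"

definition frequently_hypercyclic ::
    "nat set set \<Rightarrow> ('a::topological_space \<Rightarrow> 'a) \<Rightarrow> bool"
  where "frequently_hypercyclic \<A> T \<longleftrightarrow>
    (\<exists>x. \<forall>V. open V \<longrightarrow> V \<noteq> {} \<longrightarrow> return_set T x V \<in> \<A>)"

definition uncond_convergent_uniformly ::
    "('a::ab_group_add \<Rightarrow> real) \<Rightarrow> (nat \<Rightarrow> 'a) \<Rightarrow> (nat \<Rightarrow> nat set) \<Rightarrow> nat \<Rightarrow> bool"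
  where "uncond_convergent_uniformly nrm f A k\<^sub>0 \<longleftrightarrow>
    (\<forall>\<epsilon>>0. \<exists>N\<ge>1. \<forall>k\<ge>k\<^sub>0. \<forall>F. finite F \<longrightarrow> F \<subseteq> A k \<inter> {N..} \<longrightarrow> nrm (\<Sum>n\<in>F. f n) < \<epsilon>)"

end

theory Submission
  imports Defs
begin

text \<open>
  The hypercyclic vector is a double series. Let \<open>(y\<^sub>q)\<close> be a sequence in \<open>Y\<^sub>0\<close> that comes
  arbitrarily close to every point at arbitrarily late indices, choose \<open>\<kappa> 0 < \<kappa> 1 < \<dots>\<close>, put
  \<open>B\<^sub>p = A\<^bsub>\<kappa> p\<^esub>\<close>, and take the vector \<open>x = (\<Sum>p. \<Sum>n\<in>B\<^sub>p. S\<^sub>n y\<^sub>p)\<close>. For \<open>n \<in> B\<^sub>q\<close> the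
  term with index \<open>n\<close> in row \<open>q\<close> becomes \<open>T\<^sup>n S\<^sub>n y\<^sub>q\<close>, which is close to \<open>y\<^sub>q\<close> because \<open>S\<^sub>n\<close> is
  an approximate right inverse of \<open>T\<^sup>n\<close> on \<open>A\<^sub>k\<close> for large \<open>k\<close>, while the off-diagonal hypothesis
  on the sums \<open>\<Sum>i\<in>F. T\<^sup>n S\<^sub>i y\<close> with \<open>n \<notin> F\<close> makes everything else small.
  Once \<open>T\<^sup>n x\<close> is within \<open>3 (1/2)\<^sup>q\<close> of \<open>y\<^sub>q\<close> for all \<open>n \<in> B\<^sub>q\<close>,
  then every nonempty open \<open>V\<close> has some \<open>B\<^sub>q\<close> inside its return set, and \<open>B\<^sub>q\<close> belongs to the
  upward closed family.

  The error at a time \<open>n \<in> B\<^sub>q\<close> has to be at most \<open>(1/2)\<^bsup>p+q\<^esup>\<close> from row \<open>p\<close>, so that the sum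
  over \<open>p\<close> is at most \<open>2 (1/2)\<^sup>q\<close>. The two halves of the off-diagonal hypothesis
  serve the two sides of the diagonal. For \<open>p \<ge> q\<close> the first half, with \<open>\<epsilon> = (1/2)\<^bsup>2p\<^esup>\<close>, bounds row \<open>p\<close> at all times
  in all the sets at once; this is a property of \<open>\<kappa> p\<close> alone. For \<open>p < q\<close> the second half provides a
  threshold beyond which \<open>\<kappa> q\<close> has to lie, and it depends only on \<open>p\<close>, \<open>q\<close> and the earlier choice \<open>\<kappa> p\<close>.
  Hence \<open>\<kappa>\<close> can be chosen recursively (\<open>dependent_frequently_choice\<close>): each new index has to satisfy one condition
  that holds for arbitrarily large indices and finitely many that hold for all large ones.

  Convergence of the double series rests on a remark about disjointness. A given initial segment
  of the naturals meets only finitely many of the sets \<open>A\<^sub>k\<close>, so the tail estimate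
  of the uniform unconditional convergence is, for large \<open>k\<close>, an estimate on all finite sums over \<open>A\<^sub>k\<close>
  (\<open>uncond_convergent_uniformly_eventually_small\<close>). Thus row \<open>p\<close> may be taken of size at
  most \<open>(1/2)\<^sup>p\<close>, and the partial sums over \<open>p \<le> m, n \<le> m\<close> are Cauchy
  (\<open>double_sum_Cauchy\<close>). The powers of \<open>T\<close> act only on these finite sums, and continuity
  transfers the estimates to the limit.
\<close>

section \<open>Translation-invariant norms on topological groups\<close>

text \<open>
  The estimates add and subtract vectors but never scale them, so they are stated for a norm on an
  additive group. Every F-norm is one.
\<close>

locale group_norm =
  fixes nrm :: "'a::topological_ab_group_add \<Rightarrow> real"
  assumes nrm_nonneg: "0 \<le> nrm x"
    and nrm_triangle: "nrm (x + y) \<le> nrm x + nrm y"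
    and nrm_zero: "nrm 0 = 0"
    and nrm_eq_zero: "nrm x = 0 \<Longrightarrow> x = 0"
    and nrm_uminus: "nrm (- x) = nrm x"
    and topology: "induces_topology nrm"
begin

lemma minus_commute: "nrm (x - y) = nrm (y - x)"
  using nrm_uminus[of "x - y"] by simp

lemma triangle_diff: "nrm (x - z) \<le> nrm (x - y) + nrm (y - z)"
  using nrm_triangle[of "x - y" "y - z"] by simp

sublocale Metric_space UNIV "\<lambda>x y. nrm (x - y)"
proof
  show "0 \<le> nrm (x - y)" for x y by (rule nrm_nonneg)
  show "nrm (x - y) = nrm (y - x)" for x y by (rule minus_commute)
  show "nrm (x - y) = 0 \<longleftrightarrow> x = y" for x y using nrm_eq_zero[of "x - y"] nrm_zero by auto
  show "nrm (x - z) \<le> nrm (x - y) + nrm (y - z)" for x y z by (rule triangle_diff)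
qed

lemma mtopology_eq: "mtopology = euclidean"
  using topology by (simp add: induces_topology_def)

lemma open_contains_ball:
  assumes "open V" "v \<in> V"
  obtains r where "r > 0" "\<And>z. nrm (z - v) < r \<Longrightarrow> z \<in> V"
proof -
  have "openin mtopology V" using assms by (simp add: mtopology_eq)
  with \<open>v \<in> V\<close> obtain r where "r > 0" "mball v r \<subseteq> V"
    unfolding openin_mtopology by blast
  then show thesis
    using that[of r] by (auto simp: in_mball subset_iff minus_commute)
qed

lemma open_ball: "open {z. nrm (z - v) < r}"
proof -
  have "{z. nrm (z - v) < r} = mball v r"
    by (auto simp: in_mball minus_commute)
  then show ?thesis
    using openin_mball[of v r] by (simp add: mtopology_eq)
qed

lemma tendsto_iff_nrm: "(f \<longlongrightarrow> l) F \<longleftrightarrow> ((\<lambda>i. nrm (f i - l)) \<longlongrightarrow> 0) F"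
proof -
  have "(f \<longlongrightarrow> l) F \<longleftrightarrow> limitin mtopology f l F"
    by (simp add: mtopology_eq)
  then show ?thesis
    by (simp add: limitin_metric tendsto_iff nrm_nonneg)
qed

lemma sum_bound:
  assumes "\<And>i. i \<in> I \<Longrightarrow> nrm (f i) \<le> b i"
  shows "nrm (sum f I) \<le> sum b I"
proof (cases "finite I")
  case True
  then show ?thesis using assms
    by (induction I) (auto simp: nrm_zero intro: order.trans[OF nrm_triangle add_mono])
qed (simp add: nrm_zero)

lemma lim_diff_le:
  assumes "(f \<longlongrightarrow> l) F" "F \<noteq> bot" "\<forall>\<^sub>F i in F. nrm (f i - c) \<le> b"
  shows "nrm (l - c) \<le> b"
proof -
  have "\<forall>\<^sub>F i in F. nrm (l - c) \<le> nrm (f i - l) + b"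
    using assms(3)
  proof eventually_elim
    case (elim i)
    with triangle_diff[of l c "f i"] minus_commute[of l "f i"] show ?case by simp
  qed
  moreover have "((\<lambda>i. nrm (f i - l) + b) \<longlongrightarrow> 0 + b) F"
    using assms(1) by (intro tendsto_intros) (simp add: tendsto_iff_nrm)
  ultimately show ?thesis
    using assms(2) tendsto_lowerbound by fastforce
qed

text \<open>
  Completeness is given for some invariant metric \<open>d\<close>, not for the norm. It carries over because
  invariance reduces being Cauchy to the neighbourhoods of zero, and both metrics have the same
  ones.
\<close>

lemma Cauchy_convergent:
  assumes d: "Metric_space UNIV d" "\<And>x y z. d (x + z) (y + z) = d x y"
    "Metric_space.mtopology UNIV d = (euclidean :: 'a topology)" "Metric_space.mcomplete UNIV d"
    and Cauchy: "\<And>\<epsilon>. \<epsilon> > 0 \<Longrightarrow> \<exists>M. \<forall>m\<ge>M. \<forall>m'\<ge>m. nrm (u m' - u m) < \<epsilon>"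
  shows "\<exists>l. u \<longlonglongrightarrow> l"
proof -
  interpret d: Metric_space UNIV d by fact
  have "d.MCauchy u"
    unfolding d.MCauchy_def
  proof (intro conjI allI impI)
    fix \<epsilon> :: real assume "\<epsilon> > 0"
    have "open (d.mball 0 \<epsilon>)"
      using d.openin_mball[of 0 \<epsilon>] d(3) by simp
    moreover have "0 \<in> d.mball 0 \<epsilon>" using \<open>\<epsilon> > 0\<close> by simp
    ultimately obtain r where r: "r > 0" "\<And>z. nrm z < r \<Longrightarrow> d 0 z < \<epsilon>"
      using open_contains_ball[of "d.mball 0 \<epsilon>" 0] by (auto simp: d.in_mball)
    obtain M where M: "\<And>m m'. m \<ge> M \<Longrightarrow> m' \<ge> m \<Longrightarrow> nrm (u m' - u m) < r"
      using Cauchy[OF r(1)] by blast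
    have *: "d (u m) (u m') < \<epsilon>" if "m \<ge> M" "m' \<ge> m" for m m'
      using r(2)[OF M[OF that]] d(2)[of 0 "u m" "u m' - u m"] by simp
    show "\<exists>N. \<forall>n n'. N \<le> n \<longrightarrow> N \<le> n' \<longrightarrow> d (u n) (u n') < \<epsilon>"
      using * by (intro exI[of _ M]) (metis d.commute nle_le)
  qed simp
  then obtain l where "limitin d.mtopology u l sequentially"
    using d(4) unfolding d.mcomplete_def by blast
  then show ?thesis using d(3) by auto
qed

text \<open>
  The sequence approximates the \<open>i\<close>-th point of a countable dense set within \<open>(1/2)\<^sup>j\<close> for every
  pair \<open>(i, j)\<close>. Since \<open>j\<close> is arbitrarily large, good approximations occur at
  arbitrarily late indices even if the space is trivial.
\<close>

lemma dense_sequence_in: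
  assumes sep: "separable_space (euclidean :: 'a topology)" and dense: "closure Y = UNIV"
  obtains y :: "nat \<Rightarrow> 'a" where "\<And>q. y q \<in> Y"
    and "\<And>v r Q. r > 0 \<Longrightarrow> \<exists>q\<ge>Q. nrm (y q - v) < r"
proof -
  obtain C where C: "countable C" "closure C = (UNIV :: 'a set)"
    using sep by (auto simp: separable_space_def)
  define e where "e = from_nat_into C"
  have meets: "\<exists>z\<in>D. nrm (z - v) < r" if "closure D = UNIV" "r > 0" for D v and r :: real
  proof -
    have "v \<in> {z. nrm (z - v) < r} \<inter> closure D" using that nrm_zero by simp
    then have "{z. nrm (z - v) < r} \<inter> D \<noteq> {}"
      using open_Int_closure_eq_empty[OF open_ball[of v r], of D] by blast
    then show ?thesis by auto
  qed
  have "\<forall>q. \<exists>z\<in>Y. nrm (z - e (fst (prod_decode q))) < (1/2) ^ snd (prod_decode q)"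
    by (intro allI meets[OF dense]) simp
  then obtain y :: "nat \<Rightarrow> 'a" where y: "\<And>q. y q \<in> Y"
    "\<And>q. nrm (y q - e (fst (prod_decode q))) < (1/2) ^ snd (prod_decode q)"
    by metis
  have "\<exists>q\<ge>Q. nrm (y q - v) < r" if "r > 0" for v r Q
  proof -
    obtain z where z: "z \<in> C" "nrm (z - v) < r / 2"
      using meets[OF C(2), of "r / 2" v] half_gt_zero[OF \<open>r > 0\<close>] by blast
    obtain i where i: "e i = z"
      using from_nat_into_surj[OF C(1) z(1)] by (auto simp: e_def)
    have "(\<lambda>j. (1/2::real) ^ j) \<longlonglongrightarrow> 0" by (simp add: LIMSEQ_realpow_zero)
    then have "\<forall>\<^sub>F j in sequentially. (1/2::real) ^ j < r / 2"
      using that by (intro order_tendstoD(2)) auto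
    then obtain j where j: "j \<ge> Q" "(1/2::real) ^ j < r / 2"
      by (metis eventually_at_top_linorder nle_le)
    have "nrm (y (prod_encode (i, j)) - z) < (1/2) ^ j"
      using y(2)[of "prod_encode (i, j)"] i by simp
    then have "nrm (y (prod_encode (i, j)) - v) < r"
      using triangle_diff[of "y (prod_encode (i, j))" v z] z(2) j(2) by linarith
    moreover have "prod_encode (i, j) \<ge> Q"
      using j(1) le_prod_encode_2[of j i] by linarith
    ultimately show ?thesis by blast
  qed
  then show thesis using that[of y] y(1) by blast
qed

text \<open>
  Each row has small tails, and the rows beyond some \<open>P\<close> together contribute little, by the
  summable bound. Passing from a square partial sum to a larger one adds in each row only a
  finite set of terms; for \<open>p < P\<close> that set lies in the tail of row \<open>p\<close>.
\<close>

lemma double_sum_Cauchy: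
  fixes f :: "nat \<Rightarrow> nat \<Rightarrow> 'a" and B :: "nat \<Rightarrow> nat set"
  assumes bound: "\<And>p F. finite F \<Longrightarrow> F \<subseteq> B p \<Longrightarrow> nrm (\<Sum>n\<in>F. f p n) \<le> b p"
    and b: "summable b"
    and tail: "\<And>p \<epsilon>. \<epsilon> > 0 \<Longrightarrow>
      \<exists>N. \<forall>F. finite F \<longrightarrow> F \<subseteq> B p \<inter> {N..} \<longrightarrow> nrm (\<Sum>n\<in>F. f p n) < \<epsilon>"
    and "\<epsilon> > 0"
  shows "\<exists>M. \<forall>m\<ge>M. \<forall>m'\<ge>m.
    nrm ((\<Sum>p\<le>m'. \<Sum>n\<in>B p \<inter> {..m'}. f p n) - (\<Sum>p\<le>m. \<Sum>n\<in>B p \<inter> {..m}. f p n)) < \<epsilon>"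
proof -
  obtain P where P: "\<And>m. norm (sum b {P..<m}) < \<epsilon> / 2"
    using b \<open>\<epsilon> > 0\<close> unfolding summable_Cauchy by (meson half_gt_zero order_refl)
  define \<delta> where "\<delta> = \<epsilon> / 2 / (real P + 1)"
  have "\<delta> > 0" using \<open>\<epsilon> > 0\<close> by (simp add: \<delta>_def)
  then obtain N where N: "\<And>p F. finite F \<Longrightarrow> F \<subseteq> B p \<inter> {N p..} \<Longrightarrow> nrm (\<Sum>n\<in>F. f p n) < \<delta>"
    using tail by metis
  define M where "M = Max (insert P (N ` {..<P}))"
  have NM: "N p \<le> M" if "p < P" for p
    using that by (auto simp: M_def intro!: Max_ge)
  have PM: "P \<le> M" by (simp add: M_def)
  have "nrm ((\<Sum>p\<le>m'. \<Sum>n\<in>B p \<inter> {..m'}. f p n) - (\<Sum>p\<le>m. \<Sum>n\<in>B p \<inter> {..m}. f p n)) < \<epsilon>"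
    if m: "m \<ge> M" "m' \<ge> m" for m m'
  proof -
    \<comment> \<open>the indices that row \<open>p\<close> gains between the two squares; a row beyond \<open>m\<close> is entirely new\<close>
    define D where "D p = B p \<inter> {..m'} - (if p \<le> m then {..m} else {})" for p
    have fin: "finite (D p)" "D p \<subseteq> B p" for p by (auto simp: D_def)
    have split: "(\<Sum>n\<in>B p \<inter> {..m'}. f p n)
      = (\<Sum>n\<in>D p. f p n) + (if p \<le> m then \<Sum>n\<in>B p \<inter> {..m}. f p n else 0)" for p
    proof -
      have "B p \<inter> {..m'} - B p \<inter> {..m} = B p \<inter> {..m'} - {..m}" by auto
      moreover have "B p \<inter> {..m} \<subseteq> B p \<inter> {..m'}" using m by auto
      ultimately show ?thesis
        using sum.subset_diff[of "B p \<inter> {..m}" "B p \<inter> {..m'}" "f p"] by (auto simp: D_def)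
    qed
    have "(\<Sum>p\<le>m'. if p \<le> m then \<Sum>n\<in>B p \<inter> {..m}. f p n else 0)
        = (\<Sum>p\<le>m. \<Sum>n\<in>B p \<inter> {..m}. f p n)"
      using m(2) by (intro sum.mono_neutral_cong_right) auto
    then have "(\<Sum>p\<le>m'. \<Sum>n\<in>B p \<inter> {..m'}. f p n) - (\<Sum>p\<le>m. \<Sum>n\<in>B p \<inter> {..m}. f p n)
        = (\<Sum>p\<le>m'. \<Sum>n\<in>D p. f p n)"
      by (simp add: split sum.distrib)
    also have "\<dots> = (\<Sum>p\<in>{..<P} \<union> {P..<Suc m'}. \<Sum>n\<in>D p. f p n)"
      using PM m by (intro sum.cong) auto
    also have "\<dots> = (\<Sum>p<P. \<Sum>n\<in>D p. f p n) + (\<Sum>p=P..<Suc m'. \<Sum>n\<in>D p. f p n)"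
      by (intro sum.union_disjoint) auto
    finally have eq: "(\<Sum>p\<le>m'. \<Sum>n\<in>B p \<inter> {..m'}. f p n) - (\<Sum>p\<le>m. \<Sum>n\<in>B p \<inter> {..m}. f p n)
        = (\<Sum>p<P. \<Sum>n\<in>D p. f p n) + (\<Sum>p=P..<Suc m'. \<Sum>n\<in>D p. f p n)" .
    have "nrm (\<Sum>p<P. \<Sum>n\<in>D p. f p n) \<le> (\<Sum>p<P. \<delta>)"
    proof (rule sum_bound)
      fix p assume p: "p \<in> {..<P}"
      then have "D p \<subseteq> B p \<inter> {N p..}" using NM[of p] PM m by (auto simp: D_def)
      then show "nrm (\<Sum>n\<in>D p. f p n) \<le> \<delta>" using N[OF fin(1)] less_imp_le by blast
    qed
    also have "\<dots> < \<epsilon> / 2" using \<open>\<epsilon> > 0\<close> by (simp add: \<delta>_def field_simps)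
    finally have head: "nrm (\<Sum>p<P. \<Sum>n\<in>D p. f p n) < \<epsilon> / 2" .
    have "nrm (\<Sum>p=P..<Suc m'. \<Sum>n\<in>D p. f p n) \<le> sum b {P..<Suc m'}"
      using bound[OF fin] by (intro sum_bound)
    also have "\<dots> < \<epsilon> / 2" using P[of "Suc m'"] by (simp add: abs_less_iff)
    finally show ?thesis
      unfolding eq using head nrm_triangle[of "\<Sum>p<P. \<Sum>n\<in>D p. f p n" "\<Sum>p=P..<Suc m'. \<Sum>n\<in>D p. f p n"] by linarith
  qed
  then show ?thesis by blast
qed

text \<open>
  Disjointness of the rows ensures that \<open>n\<close> occurs as an index in row \<open>q\<close> only. Removing that one
  term, which \<open>L\<close> sends close to \<open>y\<close>, leaves finite sums that avoid \<open>n\<close>. Here \<open>L\<close> stands for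
  the power \<open>T\<^sup>n\<close>.
\<close>

lemma hitting_estimate:
  fixes s :: "nat \<Rightarrow> nat \<Rightarrow> 'a" and B :: "nat \<Rightarrow> nat set"
  assumes L: "Modules.additive L"
    and disj: "disjoint_family B" and n: "n \<in> B q" "n \<le> m" "q \<le> m"
    and small: "\<And>p F. finite F \<Longrightarrow> F \<subseteq> B p \<Longrightarrow> n \<notin> F \<Longrightarrow> nrm (\<Sum>i\<in>F. L (s p i)) \<le> b p"
    and b: "sum b {..m} \<le> \<beta>"
    and close: "nrm (L (s q n) - y) \<le> \<gamma>"
  shows "nrm (L (\<Sum>p\<le>m. \<Sum>i\<in>B p \<inter> {..m}. s p i) - y) \<le> \<beta> + \<gamma>"
proof -
  have row: "(\<Sum>i\<in>B p \<inter> {..m}. L (s p i))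
      = (\<Sum>i\<in>B p \<inter> {..m} - {n}. L (s p i)) + (if p = q then L (s q n) else 0)" for p
  proof (cases "p = q")
    case True
    then show ?thesis using n sum.remove[of "B p \<inter> {..m}" n "\<lambda>i. L (s p i)"] by (simp add: add.commute)
  next
    case False
    then have "n \<notin> B p" using disj n(1) by (auto simp: disjoint_family_on_def)
    then show ?thesis using False by simp
  qed
  have "L (\<Sum>p\<le>m. \<Sum>i\<in>B p \<inter> {..m}. s p i) - y
      = (\<Sum>p\<le>m. \<Sum>i\<in>B p \<inter> {..m} - {n}. L (s p i)) + (L (s q n) - y)"
    using n(3) by (simp add: Modules.additive.sum[OF L] row sum.distrib)
  also have "nrm \<dots> \<le> nrm (\<Sum>p\<le>m. \<Sum>i\<in>B p \<inter> {..m} - {n}. L (s p i)) + nrm (L (s q n) - y)"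
    by (rule nrm_triangle)
  also have "nrm (\<Sum>p\<le>m. \<Sum>i\<in>B p \<inter> {..m} - {n}. L (s p i)) \<le> sum b {..m}"
    by (intro sum_bound small) auto
  finally show ?thesis using b close by linarith
qed

end

section \<open>F-norms\<close>

lemma F_norm_zero:
  fixes scl :: "'k::real_normed_field \<Rightarrow> 'a::ab_group_add \<Rightarrow> 'a"
  assumes "vector_space scl" "F_norm scl nrm"
  shows "nrm 0 = 0"
proof -
  interpret vector_space scl by fact
  have "((\<lambda>c. nrm (scl c 0)) \<longlongrightarrow> 0) (at 0)"
    using assms(2) unfolding F_norm_def by blast
  then have "((\<lambda>c::'k. nrm 0) \<longlongrightarrow> 0) (at 0)" by simp
  then show ?thesis using tendsto_const_iff[OF at_neq_bot] by blast
qed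

text \<open>
  The contraction axiom covers only scalars of norm less than one, and so says nothing about
  \<open>-1\<close>. Writing \<open>- x = - (1 - t) x - t x\<close> with small \<open>t > 0\<close> leaves the error \<open>- t x\<close>,
  which vanishes as \<open>t\<close> tends to zero.
\<close>

lemma F_norm_uminus_le:
  fixes scl :: "'k::real_normed_field \<Rightarrow> 'a::ab_group_add \<Rightarrow> 'a"
  assumes "vector_space scl" "F_norm scl nrm"
  shows "nrm (- x) \<le> nrm x"
proof -
  interpret vector_space scl by fact
  have "\<forall>\<^sub>F t in at_right 0. nrm (- x) \<le> nrm x + nrm (scl (- of_real t) x)"
    using eventually_at_right_real[of 0 1, simplified]
  proof eventually_elim
    case (elim t)
    have "norm (- (1 - of_real t) :: 'k) = norm (of_real (1 - t) :: 'k)"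
      by (metis norm_minus_cancel of_real_1 of_real_diff)
    then have "norm (- (1 - of_real t) :: 'k) < 1"
      using elim by (simp del: of_real_diff)
    then have "nrm (scl (- (1 - of_real t)) x) \<le> nrm x"
      using assms(2) unfolding F_norm_def by blast
    moreover have "- x = scl (- (1 - of_real t)) x + scl (- of_real t) x"
      by (simp add: scale_left_diff_distrib scale_minus_left)
    ultimately show ?case
      using assms(2) unfolding F_norm_def by (metis add.commute add_left_mono order.trans)
  qed
  moreover have "((\<lambda>t. nrm (scl (- of_real t) x)) \<longlongrightarrow> 0) (at_right 0)"
  proof (rule filterlim_compose[where g = "\<lambda>c. nrm (scl c x)"])
    show "((\<lambda>c. nrm (scl c x)) \<longlongrightarrow> 0) (at 0)"
      using assms(2) by (simp add: F_norm_def)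
    have "((\<lambda>t. - of_real t :: 'k) \<longlongrightarrow> - of_real 0) (at_right 0)"
      by (intro tendsto_intros)
    then show "LIM t at_right 0. - of_real t :> at (0::'k)"
      by (auto simp: filterlim_at eventually_at_filter)
  qed
  then have "((\<lambda>t. nrm x + nrm (scl (- of_real t) x)) \<longlongrightarrow> nrm x + 0) (at_right 0)"
    by (intro tendsto_intros)
  ultimately show ?thesis
    using tendsto_lowerbound[of _ "nrm x + 0" "at_right (0::real)"] by simp
qed

lemma F_norm_group_norm:
  fixes scl :: "'k::real_normed_field \<Rightarrow> 'a::topological_ab_group_add \<Rightarrow> 'a"
  assumes "vector_space scl" "F_norm scl nrm" "induces_topology nrm"
  shows "group_norm nrm"
proof
  show "nrm (- x) = nrm x" for x
    using F_norm_uminus_le[OF assms(1,2), of x] F_norm_uminus_le[OF assms(1,2), of "- x"] by simp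
qed (use assms F_norm_zero[OF assms(1,2)] in \<open>auto simp: F_norm_def\<close>)

section \<open>Selection of the rows\<close>

text \<open>
  A condition that holds for arbitrarily large indices is compatible with finitely many that
  hold for all large indices, so the recursion never gets stuck.
\<close>

lemma dependent_frequently_choice:
  fixes good :: "nat \<Rightarrow> nat \<Rightarrow> bool" and compat :: "nat \<Rightarrow> nat \<Rightarrow> nat \<Rightarrow> nat \<Rightarrow> bool"
  assumes freq: "\<And>q. \<exists>\<^sub>F k in sequentially. good q k"
    and late: "\<And>p q k. good p k \<Longrightarrow> \<forall>\<^sub>F l in sequentially. compat p q k l"
  obtains \<kappa> where "\<And>q. good q (\<kappa> q)" "\<And>p q. p < q \<Longrightarrow> compat p q (\<kappa> p) (\<kappa> q)"
proof -
  have "\<exists>\<kappa>. \<forall>q. good q (\<kappa> q) \<and> (\<forall>p<q. compat p q (\<kappa> p) (\<kappa> q))"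
  proof (rule dependent_wf_choice[OF wf_less_than])
    fix q \<kappa> assume *: "\<And>p. (p, q) \<in> less_than \<Longrightarrow> good p (\<kappa> p) \<and> (\<forall>p'<p. compat p' p (\<kappa> p') (\<kappa> p))"
    have "\<forall>\<^sub>F k in sequentially. \<forall>p\<in>{..<q}. compat p q (\<kappa> p) k"
      using * by (intro eventually_ball_finite ballI late) auto
    then have "\<exists>\<^sub>F k in sequentially. good q k \<and> (\<forall>p\<in>{..<q}. compat p q (\<kappa> p) k)"
      using frequently_eventually_conj[OF freq[of q], of "\<lambda>k. \<forall>p\<in>{..<q}. compat p q (\<kappa> p) k"]
      by (simp add: conj_commute)
    then show "\<exists>k. good q k \<and> (\<forall>p<q. compat p q (\<kappa> p) k)"
      by (auto dest!: frequently_ex)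
  qed auto
  then show thesis using that by blast
qed

text \<open>Each number below \<open>N\<close> lies in at most one of the sets.\<close>

lemma disjoint_family_eventually_avoids:
  fixes A :: "nat \<Rightarrow> nat set"
  assumes "disjoint_family_on A {1..}"
  shows "\<forall>\<^sub>F k in sequentially. A k \<inter> {..<N} = {}"
proof -
  have "\<forall>\<^sub>F k in sequentially. n \<notin> A k" for n
  proof (cases "\<exists>k\<ge>1. n \<in> A k")
    case True
    then obtain k where "k \<ge> 1" "n \<in> A k" by blast
    have "n \<notin> A l" if "l > k" for l
    proof -
      have "A k \<inter> A l = {}"
        using disjoint_family_onD[OF assms, of k l] \<open>k \<ge> 1\<close> that by simp
      then show ?thesis using \<open>n \<in> A k\<close> by blast
    qed
    then show ?thesis by (rule eventually_mono[OF eventually_gt_at_top[of k]])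
  next
    case False
    then show ?thesis by (intro eventually_mono[OF eventually_ge_at_top[of 1]]) blast
  qed
  then have "\<forall>\<^sub>F k in sequentially. \<forall>n\<in>{..<N}. n \<notin> A k"
    by (intro eventually_ball_finite ballI) simp_all
  then show ?thesis by (rule eventually_mono) blast
qed

lemma uncond_convergent_uniformly_tail:
  assumes "uncond_convergent_uniformly nrm f A k\<^sub>0" "\<epsilon> > 0"
  obtains N where "\<And>k F. k \<ge> k\<^sub>0 \<Longrightarrow> finite F \<Longrightarrow> F \<subseteq> A k \<inter> {N..} \<Longrightarrow> nrm (\<Sum>n\<in>F. f n) < \<epsilon>"
  using assms unfolding uncond_convergent_uniformly_def by meson

text \<open>
  For large \<open>k\<close> the whole of \<open>A k\<close> lies in the tail on which the uniform estimate holds.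
\<close>

lemma uncond_convergent_uniformly_eventually_small:
  assumes "uncond_convergent_uniformly nrm f A k\<^sub>0" "disjoint_family_on A {1..}" "\<epsilon> > 0"
  shows "\<forall>\<^sub>F k in sequentially. \<forall>F. finite F \<longrightarrow> F \<subseteq> A k \<longrightarrow> nrm (\<Sum>n\<in>F. f n) < \<epsilon>"
proof -
  obtain N where N: "\<And>k F. k \<ge> k\<^sub>0 \<Longrightarrow> finite F \<Longrightarrow> F \<subseteq> A k \<inter> {N..} \<Longrightarrow> nrm (\<Sum>n\<in>F. f n) < \<epsilon>"
    using uncond_convergent_uniformly_tail[OF assms(1,3)] by metis
  show ?thesis
    using disjoint_family_eventually_avoids[OF assms(2), of N] eventually_ge_at_top[of k\<^sub>0]
  proof eventually_elim
    case (elim k)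
    then have "A k \<subseteq> {N..}" by (auto simp: disjoint_iff not_less)
    then show ?case using N[OF elim(2)] by blast
  qed
qed

lemma sum_half_powers_le: "(\<Sum>p\<le>m. (1/2::real) ^ (p + q)) \<le> 2 * (1/2) ^ q"
proof -
  have "(\<Sum>p\<le>m. (1/2::real) ^ p) \<le> 2"
    using sum_gp0[of "1/2::real" m] by simp
  then show ?thesis
    by (simp add: power_add sum_distrib_right[symmetric])
qed

section \<open>The frequent hypercyclicity criterion\<close>

theorem theorem9:
  fixes scl :: "'k::real_normed_field \<Rightarrow> 'a::topological_ab_group_add \<Rightarrow> 'a"
    and nrm :: "'a \<Rightarrow> real"
    and T :: "'a \<Rightarrow> 'a"
    and \<A> :: "nat set set"
    and Y\<^sub>0 :: "'a set"
    and S :: "nat \<Rightarrow> 'a \<Rightarrow> 'a"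
    and A :: "nat \<Rightarrow> nat set"
  assumes "F_space scl"
    and "separable_space (euclidean :: 'a topology)"
    and "Vector_Spaces.linear scl scl T"
    and "continuous_on UNIV T"
    and "hypercyclicity_set \<A>"
    and "F_norm scl nrm"
    and "induces_topology nrm"
    and "closure Y\<^sub>0 = UNIV"
    and "\<And>k. k \<ge> 1 \<Longrightarrow> A k \<in> \<A>"
    and "disjoint_family_on A {1..}"
    and "\<And>y. y \<in> Y\<^sub>0 \<Longrightarrow> \<exists>k\<^sub>0\<ge>1. uncond_convergent_uniformly nrm (\<lambda>n. S n y) A k\<^sub>0"
    and "\<And>y k\<^sub>0 \<epsilon>. y \<in> Y\<^sub>0 \<Longrightarrow> k\<^sub>0 \<ge> 1 \<Longrightarrow> \<epsilon> > 0 \<Longrightarrow>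
      \<exists>k\<ge>k\<^sub>0.
        (\<forall>F n. finite F \<longrightarrow> F \<subseteq> A k \<longrightarrow> n \<in> (\<Union>l\<in>{1..}. A l) \<longrightarrow> n \<notin> F \<longrightarrow>
           nrm (\<Sum>i\<in>F. (T ^^ n) (S i y)) \<le> \<epsilon>) \<and>
        (\<forall>\<delta>>0. \<exists>l\<^sub>0\<ge>1. \<forall>F n. finite F \<longrightarrow> F \<subseteq> A k \<longrightarrow> n \<in> (\<Union>l\<in>{l\<^sub>0..}. A l) \<longrightarrow> n \<notin> F \<longrightarrow>
           nrm (\<Sum>i\<in>F. (T ^^ n) (S i y)) \<le> \<delta>)"
    and "\<And>y. y \<in> Y\<^sub>0 \<Longrightarrow>
      (\<lambda>k. SUP n\<in>A k. ereal (nrm ((T ^^ n) (S n y) - y))) \<longlonglongrightarrow> 0"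
  shows "frequently_hypercyclic \<A> T"
proof -
  interpret F_space scl by (rule assms(1))
  interpret group_norm nrm
    by (rule F_norm_group_norm[OF vector_space_axioms assms(6,7)])
  interpret T: Vector_Spaces.linear scl scl T by (rule assms(3))
  have T_add: "Modules.additive (T ^^ n)" for n
    by (induction n) (auto simp: Modules.additive_def T.add)
  have T_cont: "continuous_on UNIV (T ^^ n)" for n
  proof (induction n)
    case (Suc n)
    then show ?case
      using continuous_on_compose[of UNIV "T ^^ n" T] continuous_on_subset[OF assms(4)] by simp
  qed (simp add: continuous_on_id)
  obtain y :: "nat \<Rightarrow> 'a" where y: "\<And>q. y q \<in> Y\<^sub>0"
    and y_dense: "\<And>v r Q. r > 0 \<Longrightarrow> \<exists>q\<ge>Q. nrm (y q - v) < r"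
    using dense_sequence_in[OF assms(2,8)] by metis

  define conv where "conv q k \<longleftrightarrow> (\<forall>\<epsilon>>0. \<exists>N. \<forall>F. finite F \<longrightarrow> F \<subseteq> A k \<inter> {N..} \<longrightarrow>
      nrm (\<Sum>n\<in>F. S n (y q)) < \<epsilon>)" for q k
  define small where "small q k \<longleftrightarrow> (\<forall>F. finite F \<longrightarrow> F \<subseteq> A k \<longrightarrow>
      nrm (\<Sum>n\<in>F. S n (y q)) < (1/2) ^ q)" for q k
  define close where "close q k \<longleftrightarrow>
      (\<forall>n\<in>A k. nrm ((T ^^ n) (S n (y q)) - y q) \<le> (1/2) ^ q)" for q k
  \<comment> \<open>the off-diagonal estimate: row \<open>q\<close> placed on \<open>A k\<close>, observed at the times in the sets \<open>A l\<close>, \<open>l \<in> I\<close>\<close>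
  define off where "off q k I \<delta> \<longleftrightarrow> (\<forall>F n. finite F \<longrightarrow> F \<subseteq> A k \<longrightarrow> n \<in> (\<Union>l\<in>I. A l) \<longrightarrow> n \<notin> F \<longrightarrow>
      nrm (\<Sum>i\<in>F. (T ^^ n) (S i (y q))) \<le> \<delta>)" for q k I \<delta>
  have offI: "off q k I \<delta>" if "\<And>F n l. finite F \<Longrightarrow> F \<subseteq> A k \<Longrightarrow> l \<in> I \<Longrightarrow> n \<in> A l \<Longrightarrow> n \<notin> F \<Longrightarrow>
      nrm (\<Sum>i\<in>F. (T ^^ n) (S i (y q))) \<le> \<delta>" for q k I \<delta>
    unfolding off_def by (intro allI impI, elim UN_E) (rule that)
  have offD: "nrm (\<Sum>i\<in>F. (T ^^ n) (S i (y q))) \<le> \<delta>"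
    if "off q k I \<delta>" "finite F" "F \<subseteq> A k" "l \<in> I" "n \<in> A l" "n \<notin> F" for q k I \<delta> F n l
    using that(1)[unfolded off_def, rule_format, OF that(2,3) UN_I[where B = A, OF that(4,5)] that(6)] .
  \<comment> \<open>\<open>(1/2) ^ (q + q) \<le> (1/2) ^ (p + q)\<close> for \<open>p \<le> q\<close>: the bound needed for row \<open>q\<close> at the times
    that belong to a row \<open>p\<close> chosen no later\<close>
  define good where "good q k \<longleftrightarrow> 1 \<le> k \<and> conv q k \<and> small q k \<and> close q k \<and>
      off q k {1..} ((1/2) ^ (q + q)) \<and> (\<forall>\<delta>>0. \<exists>l\<^sub>0\<ge>1. off q k {l\<^sub>0..} \<delta>)" for q k
  define compat where "compat p q k l \<longleftrightarrow> k < l \<and> off p k {l..} ((1/2) ^ (p + q))" for p q k l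

  have "\<exists>\<^sub>F k in sequentially. good q k" for q
  proof -
    obtain k\<^sub>0 where k0: "k\<^sub>0 \<ge> 1" "uncond_convergent_uniformly nrm (\<lambda>n. S n (y q)) A k\<^sub>0"
      using assms(11)[OF y] by blast
    have "\<forall>\<^sub>F k in sequentially. small q k"
      unfolding small_def
      by (rule uncond_convergent_uniformly_eventually_small[OF k0(2) assms(10)]) simp
    moreover have "\<forall>\<^sub>F k in sequentially. conv q k"
      using eventually_ge_at_top[of k\<^sub>0]
    proof eventually_elim
      case (elim k)
      show ?case
        unfolding conv_def
      proof (intro allI impI)
        fix \<epsilon> :: real assume "\<epsilon> > 0"
        obtain N where "\<And>k F. k \<ge> k\<^sub>0 \<Longrightarrow> finite F \<Longrightarrow> F \<subseteq> A k \<inter> {N..} \<Longrightarrow>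
            nrm (\<Sum>n\<in>F. S n (y q)) < \<epsilon>"
          using uncond_convergent_uniformly_tail[OF k0(2) \<open>\<epsilon> > 0\<close>] by metis
        with elim show "\<exists>N. \<forall>F. finite F \<longrightarrow> F \<subseteq> A k \<inter> {N..} \<longrightarrow>
            nrm (\<Sum>n\<in>F. S n (y q)) < \<epsilon>" by metis
      qed
    qed
    moreover have "\<forall>\<^sub>F k in sequentially. close q k"
    proof -
      have "\<forall>\<^sub>F k in sequentially.
          (SUP n\<in>A k. ereal (nrm ((T ^^ n) (S n (y q)) - y q))) < ereal ((1/2) ^ q)"
        using assms(13)[OF y] by (rule order_tendstoD(2)) simp
      then show ?thesis
      proof eventually_elim
        case (elim k)
        then show ?case
          unfolding close_def by (auto dest: SUP_lessD intro: less_imp_le)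
      qed
    qed
    ultimately have ev: "\<forall>\<^sub>F k in sequentially. small q k \<and> conv q k \<and> close q k"
      by (intro eventually_conj)
    have "\<exists>k\<ge>K. good q k" for K
    proof -
      obtain K' where K': "\<And>k. k \<ge> K' \<Longrightarrow> small q k \<and> conv q k \<and> close q k"
        using ev by (auto simp: eventually_at_top_linorder)
      obtain k where k: "k \<ge> max (max K K') 1" "off q k {1..} ((1/2) ^ (q + q))"
          "\<forall>\<delta>>0. \<exists>l\<^sub>0\<ge>1. off q k {l\<^sub>0..} \<delta>"
        using assms(12)[OF y, of "max (max K K') 1" "(1/2) ^ (q + q)" q] unfolding off_def by auto
      with K'[of k] show ?thesis unfolding good_def by (intro exI[of _ k]) auto
    qed
    then show ?thesis
      by (simp add: frequently_sequentially)
  qed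
  moreover have "\<forall>\<^sub>F l in sequentially. compat p q k l" if "good p k" for p q k
  proof -
    have "\<forall>\<delta>>0. \<exists>l\<^sub>0\<ge>1. off p k {l\<^sub>0..} \<delta>"
      using \<open>good p k\<close> unfolding good_def by blast
    moreover have "(0::real) < (1/2) ^ (p + q)" by simp
    ultimately obtain l\<^sub>0 where l0: "off p k {l\<^sub>0..} ((1/2) ^ (p + q))" by metis
    show ?thesis
      using eventually_gt_at_top[of k] eventually_ge_at_top[of l\<^sub>0]
    proof eventually_elim
      case (elim l)
      have "off p k {l..} ((1/2) ^ (p + q))"
        using elim(2) by (intro offI offD[OF l0]) auto
      with elim(1) show ?case by (simp add: compat_def)
    qed
  qed
  ultimately obtain \<kappa> where good: "\<And>q. good q (\<kappa> q)"
    and compat: "\<And>p q. p < q \<Longrightarrow> compat p q (\<kappa> p) (\<kappa> q)"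
    using dependent_frequently_choice[of good compat] by metis
  define B where "B p = A (\<kappa> p)" for p
  have \<kappa>_ge: "\<kappa> p \<ge> 1" for p using good by (simp add: good_def)
  have "strict_mono \<kappa>" using compat by (auto simp: compat_def strict_mono_def)
  then have disj: "disjoint_family B"
    using assms(10) \<kappa>_ge unfolding disjoint_family_on_def B_def
    by (simp add: strict_mono_eq)

  define u where "u m = (\<Sum>p\<le>m. \<Sum>n\<in>B p \<inter> {..m}. S n (y p))" for m
  obtain d where d: "Metric_space UNIV d" "\<And>x y z. d (x + z) (y + z) = d x y"
    "Metric_space.mtopology UNIV d = (euclidean :: 'a topology)" "Metric_space.mcomplete UNIV d"
    using complete_invariant_metric by blast
  have "\<exists>x. u \<longlonglongrightarrow> x"
  proof (rule Cauchy_convergent[OF d])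
    fix \<epsilon> :: real assume "\<epsilon> > 0"
    show "\<exists>M. \<forall>m\<ge>M. \<forall>m'\<ge>m. nrm (u m' - u m) < \<epsilon>"
      unfolding u_def
    proof (rule double_sum_Cauchy[where b = "\<lambda>p. (1/2) ^ p"])
      show "nrm (\<Sum>n\<in>F. S n (y p)) \<le> (1/2) ^ p" if "finite F" "F \<subseteq> B p" for p F
        using good[of p] that by (auto simp: good_def small_def B_def intro: less_imp_le)
      show "\<exists>N. \<forall>F. finite F \<longrightarrow> F \<subseteq> B p \<inter> {N..} \<longrightarrow> nrm (\<Sum>n\<in>F. S n (y p)) < \<epsilon>'"
        if "\<epsilon>' > 0" for p \<epsilon>'
        using good[of p] that by (auto simp: good_def conv_def B_def)
    qed (use \<open>\<epsilon> > 0\<close> in \<open>simp_all add: summable_geometric\<close>)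
  qed
  then obtain x where x: "u \<longlonglongrightarrow> x" ..

  have hit: "nrm ((T ^^ n) x - y q) \<le> 3 * (1/2) ^ q" if n: "n \<in> B q" for n q
  proof (rule lim_diff_le)
    show "(\<lambda>m. (T ^^ n) (u m)) \<longlonglongrightarrow> (T ^^ n) x"
      using continuous_on_tendsto_compose[OF T_cont x] by simp
    have nA: "n \<in> A (\<kappa> q)" using n by (simp add: B_def)
    have off_B: "nrm (\<Sum>i\<in>F. (T ^^ n) (S i (y p))) \<le> (1/2) ^ (p + q)"
      if F: "finite F" "F \<subseteq> B p" "n \<notin> F" for p F
    proof (cases "p < q")
      case True
      then have "off p (\<kappa> p) {\<kappa> q..} ((1/2) ^ (p + q))"
        using compat by (simp add: compat_def)
      then show ?thesis by (rule offD[OF _ _ _ _ nA]) (use F in \<open>auto simp: B_def\<close>)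
    next
      case False
      have "off p (\<kappa> p) {1..} ((1/2) ^ (p + p))"
        using good by (simp add: good_def)
      then have "nrm (\<Sum>i\<in>F. (T ^^ n) (S i (y p))) \<le> (1/2) ^ (p + p)"
        by (rule offD[OF _ _ _ _ nA]) (use F \<kappa>_ge[of q] in \<open>auto simp: B_def\<close>)
      also have "\<dots> \<le> (1/2) ^ (p + q)"
        using False by (intro power_decreasing) auto
      finally show ?thesis .
    qed
    \<comment> \<open>from this \<open>m\<close> on, the partial sum contains the main term \<open>S n (y q)\<close>\<close>
    have "nrm ((T ^^ n) (u m) - y q) \<le> 3 * (1/2) ^ q" if "m \<ge> max n q" for m
    proof -
      have "nrm ((T ^^ n) (u m) - y q) \<le> 2 * (1/2) ^ q + (1/2) ^ q"
        unfolding u_def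
      proof (rule hitting_estimate[where b = "\<lambda>p. (1/2) ^ (p + q)", OF T_add disj n])
        show "nrm ((T ^^ n) (S n (y q)) - y q) \<le> (1/2) ^ q"
          using good[of q] n by (auto simp: good_def close_def B_def)
      qed (use that off_B sum_half_powers_le in auto)
      then show ?thesis by simp
    qed
    then show "\<forall>\<^sub>F m in sequentially. nrm ((T ^^ n) (u m) - y q) \<le> 3 * (1/2) ^ q"
      unfolding eventually_at_top_linorder by blast
  qed simp

  show ?thesis
    unfolding frequently_hypercyclic_def
  proof (intro exI allI impI)
    fix V :: "'a set" assume "open V" "V \<noteq> {}"
    then obtain v where "v \<in> V" by blast
    then obtain r where r: "r > 0" "\<And>z. nrm (z - v) < r \<Longrightarrow> z \<in> V"
      using open_contains_ball \<open>open V\<close> by blast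
    have "(\<lambda>q. 3 * (1/2::real) ^ q) \<longlonglongrightarrow> 3 * 0"
      by (intro tendsto_intros LIMSEQ_realpow_zero) auto
    then have "\<forall>\<^sub>F q in sequentially. 3 * (1/2::real) ^ q < r / 2"
      by (rule order_tendstoD(2)) (use r(1) in simp)
    then obtain Q where Q: "\<And>q. q \<ge> Q \<Longrightarrow> 3 * (1/2::real) ^ q < r / 2"
      by (auto simp: eventually_at_top_linorder)
    obtain q where q: "q \<ge> Q" "nrm (y q - v) < r / 2"
      using y_dense[of "r / 2"] r(1) by auto
    have "B q \<subseteq> return_set T x V"
    proof
      fix n assume "n \<in> B q"
      then have "nrm ((T ^^ n) x - v) < r"
        using hit Q[OF q(1)] q(2) triangle_diff[of "(T ^^ n) x" v "y q"] by fastforce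
      then show "n \<in> return_set T x V" using r(2) by (simp add: return_set_def)
    qed
    moreover have "B q \<in> \<A>" using assms(9) \<kappa>_ge by (simp add: B_def)
    ultimately show "return_set T x V \<in> \<A>"
      using assms(5) unfolding hypercyclicity_set_def hereditarily_upward_def by blast
  qed
qed

end
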